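(* Let $\mathcal{V}$ be a closed monoidal category (not assumed symmetric) and let $\mathcal{S}$ be a category with $\mathcal{V}$-structure. Let $K\in\operatorname{ob}\mathcal{V}$ and $X\in\operatorname{ob}\mathcal{S}$. Let $(K\otimes X,\alpha_{K,X},\{\underline\phi_{K,X,Y}\}_{Y\in\operatorname{ob}\mathcal{S}})$ and $(K\otimes' X,\alpha'_{K,X},\{\underline\phi'_{K,X,Y}\}_{Y\in\operatorname{ob}\mathcal{S}})$ be two $K$-cylinders of $X$. Then there exists a unique isomorphism $f:K\otimes X\to K\otimes' X$ of $\mathcal{S}$ such that $\alpha'_{K,X}=\underline{\mathcal{S}}(X,f)\cdot\alpha_{K,X}$.
   Context: Composition of morphisms is written $g\cdot f$. A monoidal category $\mathcal{V}=(\mathcal{V},\otimes,I,a,l,r)$ has structure isomorphisms $a_{X,Y,Z}:(X\otimes Y)\otimes Z\to X\otimes(Y\otimes Z)$, $l_X:I\otimes X\to X$, $r_X:X\otimes I\to X$. It is closed if for every $Y$ the functor $-\otimes Y$ has a right adjoint $\underline{\mathcal{V}}(Y,-)$; the adjunction bijection is $\pi_{X,Y,Z}:\mathcal{V}(X\otimes Y,Z)\to\mathcal{V}(X,\underline{\mathcal{V}}(Y,Z))$, with counit $\epsilon_Z:\underline{\mathcal{V}}(Y,Z)\otimes Y\to Z$. A category $\mathcal{S}$ has a $\mathcal{V}$-structure if it is equipped with: a functor $\underline{\mathcal{S}}(-,-):\mathcal{S}^{\mathrm{op}}\times\mathcal{S}\to\mathcal{V}$; for all $X,Y,Z$ a morphism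 $\underline{\bullet}_{X,Y,Z}:\underline{\mathcal{S}}(Y,Z)\otimes\underline{\mathcal{S}}(X,Y)\to\underline{\mathcal{S}}(X,Z)$ of $\mathcal{V}$; and a natural isomorphism $\varphi:\mathcal{S}(-,-)\to\mathcal{V}(I,\underline{\mathcal{S}}(-,-))$; such that (i) $\underline{\bullet}\cdot(\underline{\bullet}\otimes1)=\underline{\bullet}\cdot(1\otimes\underline{\bullet})\cdot a$ as morphisms $(\underline{\mathcal{S}}(Z,W)\otimes\underline{\mathcal{S}}(Y,Z))\otimes\underline{\mathcal{S}}(X,Y)\to\underline{\mathcal{S}}(X,W)$; (ii) for $f\in\mathcal{S}(X,Y)$, $\underline{\mathcal{S}}(f,Z)=\underline{\bullet}\cdot(1\otimes\varphi(f))\cdot r^{-1}:\underline{\mathcal{S}}(Y,Z)\to\underline{\mathcal{S}}(X,Z)$; (iii) for $g\in\mathcal{S}(Y,Z)$, $\underline{\mathcal{S}}(X,g)=\underline{\bullet}\cdot(\varphi(g)\otimes1)\cdot l^{-1}:\underline{\mathcal{S}}(X,Y)\to\underline{\mathcal{S}}(X,Z)$. For $K\in\operatorname{ob}\mathcal{V}$, $X\in\operatorname{ob}\mathcal{S}$, a $K$-cylinder of $X$ is a triple $(K\otimes X,\alpha_{K,X},\{\underline\phi_{K,X,Y}\}_{Y\in\operatorname{ob}\mathcal{S}})$ where $K\otimes X$ is an object of $\mathcal{S}$, $\alpha_{K,X}:K\to\underline{\mathcal{S}}(X,K\otimes X)$ is a morphism of $\mathcal{V}$, and $\underline\phi_{K,X,Y}:\underline{\mathcal{S}}(K\otimes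 X,Y)\to\underline{\mathcal{V}}(K,\underline{\mathcal{S}}(X,Y))$ is an isomorphism of $\mathcal{V}$ for every $Y$, such that $\epsilon_{\underline{\mathcal{S}}(X,Y)}\cdot(\underline\phi_{K,X,Y}\otimes1)=\underline{\bullet}\cdot(1\otimes\alpha_{K,X})$ as morphisms $\underline{\mathcal{S}}(K\otimes X,Y)\otimes K\to\underline{\mathcal{S}}(X,Y)$. *)

theory Defs
  imports Main
begin

text \<open>Every arrow carries its domain and codomain, so hom-sets are disjoint. Values of the
  operations outside the carriers \<open>Obj\<close> and \<open>Arr\<close> are irrelevant. Composition
  \<open>g \<cdot> f\<close> means first \<open>f\<close>, then \<open>g\<close>.\<close>

record ('o, 'a) category =
  Obj :: "'o set"
  Arr :: "'a set"
  Dom :: "'a \<Rightarrow> 'o"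
  Cod :: "'a \<Rightarrow> 'o"
  Ident :: "'o \<Rightarrow> 'a" ("\<one>\<index>")
  Comp :: "'a \<Rightarrow> 'a \<Rightarrow> 'a" (infixr "\<cdot>\<index>" 65)

definition hom :: "('o, 'a, 'z) category_scheme \<Rightarrow> 'o \<Rightarrow> 'o \<Rightarrow> 'a set" where
  "hom C X Y = {f \<in> Arr C. Dom C f = X \<and> Cod C f = Y}"

locale category =
  fixes C :: "('o, 'a, 'z) category_scheme" (structure)
  assumes Dom_closed: "f \<in> Arr C \<Longrightarrow> Dom C f \<in> Obj C"
    and Cod_closed: "f \<in> Arr C \<Longrightarrow> Cod C f \<in> Obj C"
    and Ident_closed: "X \<in> Obj C \<Longrightarrow> \<one> X \<in> hom C X X"
    and Comp_closed: "\<lbrakk>f \<in> hom C X Y; g \<in> hom C Y Z\<rbrakk> \<Longrightarrow> g \<cdot> f \<in> hom C X Z"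
    and Comp_Ident_right: "f \<in> hom C X Y \<Longrightarrow> f \<cdot> \<one> X = f"
    and Comp_Ident_left: "f \<in> hom C X Y \<Longrightarrow> \<one> Y \<cdot> f = f"
    and Comp_assoc: "\<lbrakk>f \<in> hom C W X; g \<in> hom C X Y; h \<in> hom C Y Z\<rbrakk>
      \<Longrightarrow> (h \<cdot> g) \<cdot> f = h \<cdot> (g \<cdot> f)"

definition inverse_arrows :: "('o, 'a, 'z) category_scheme \<Rightarrow> 'a \<Rightarrow> 'a \<Rightarrow> bool" where
  "inverse_arrows C f g \<longleftrightarrow>
     f \<in> Arr C \<and> g \<in> hom C (Cod C f) (Dom C f) \<and>
     g \<cdot>\<^bsub>C\<^esub> f = \<one>\<^bsub>C\<^esub> (Dom C f) \<and> f \<cdot>\<^bsub>C\<^esub> g = \<one>\<^bsub>C\<^esub> (Cod C f)"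

definition is_iso :: "('o, 'a, 'z) category_scheme \<Rightarrow> 'a \<Rightarrow> bool" where
  "is_iso C f \<longleftrightarrow> (\<exists>g. inverse_arrows C f g)"

definition inv_arr :: "('o, 'a, 'z) category_scheme \<Rightarrow> 'a \<Rightarrow> 'a" where
  "inv_arr C f = (THE g. inverse_arrows C f g)"

definition op_category :: "('o, 'a, 'z) category_scheme \<Rightarrow> ('o, 'a) category" where
  "op_category C =
     \<lparr>Obj = Obj C, Arr = Arr C, Dom = Cod C, Cod = Dom C, Ident = Ident C,
      Comp = (\<lambda>g f. f \<cdot>\<^bsub>C\<^esub> g)\<rparr>"

definition prod_category ::
  "('o, 'a, 'y) category_scheme \<Rightarrow> ('p, 'b, 'z) category_scheme \<Rightarrow> ('o \<times> 'p, 'a \<times> 'b) category"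
  where
  "prod_category C D =
     \<lparr>Obj = Obj C \<times> Obj D, Arr = Arr C \<times> Arr D,
      Dom = map_prod (Dom C) (Dom D), Cod = map_prod (Cod C) (Cod D),
      Ident = map_prod (Ident C) (Ident D),
      Comp = (\<lambda>(g, g') (f, f'). (g \<cdot>\<^bsub>C\<^esub> f, g' \<cdot>\<^bsub>D\<^esub> f'))\<rparr>"

record ('o, 'a, 'p, 'b) functor_data =
  F_obj :: "'o \<Rightarrow> 'p"
  F_arr :: "'a \<Rightarrow> 'b"

locale is_functor = C: category C + D: category D
  for C :: "('o, 'a, 'y) category_scheme" and D :: "('p, 'b, 'z) category_scheme" +
  fixes F :: "('o, 'a, 'p, 'b) functor_data"
  assumes F_obj_closed: "X \<in> Obj C \<Longrightarrow> F_obj F X \<in> Obj D"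
    and F_arr_closed: "f \<in> hom C X Y \<Longrightarrow> F_arr F f \<in> hom D (F_obj F X) (F_obj F Y)"
    and F_Ident: "X \<in> Obj C \<Longrightarrow> F_arr F (\<one>\<^bsub>C\<^esub> X) = \<one>\<^bsub>D\<^esub> (F_obj F X)"
    and F_Comp: "\<lbrakk>f \<in> hom C X Y; g \<in> hom C Y Z\<rbrakk>
      \<Longrightarrow> F_arr F (g \<cdot>\<^bsub>C\<^esub> f) = F_arr F g \<cdot>\<^bsub>D\<^esub> F_arr F f"

definition identity_functor :: "('o, 'a, 'o, 'a) functor_data" where
  "identity_functor = \<lparr>F_obj = (\<lambda>X. X), F_arr = (\<lambda>f. f)\<rparr>"

locale natural_isomorphism = F: is_functor C D F + G: is_functor C D G
  for C :: "('o, 'a, 'y) category_scheme" and D :: "('p, 'b, 'z) category_scheme"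
    and F G :: "('o, 'a, 'p, 'b) functor_data" +
  fixes \<tau> :: "'o \<Rightarrow> 'b"
  assumes component_closed: "X \<in> Obj C \<Longrightarrow> \<tau> X \<in> hom D (F_obj F X) (F_obj G X)"
    and component_iso: "X \<in> Obj C \<Longrightarrow> is_iso D (\<tau> X)"
    and naturality: "f \<in> hom C X Y \<Longrightarrow> \<tau> Y \<cdot>\<^bsub>D\<^esub> F_arr F f = F_arr G f \<cdot>\<^bsub>D\<^esub> \<tau> X"

text \<open>\<open>\<pi> X Z\<close> is the bijection \<open>D(F X, Z) \<rightarrow> C(X, G Z)\<close>, natural in \<open>X\<close> and \<open>Z\<close>.\<close>

locale adjunction = F: is_functor C D F + G: is_functor D C G
  for C :: "('o, 'a, 'y) category_scheme" and D :: "('p, 'b, 'z) category_scheme"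
    and F :: "('o, 'a, 'p, 'b) functor_data" and G :: "('p, 'b, 'o, 'a) functor_data" +
  fixes \<pi> :: "'o \<Rightarrow> 'p \<Rightarrow> 'b \<Rightarrow> 'a"
  assumes adj_bij: "\<lbrakk>X \<in> Obj C; Z \<in> Obj D\<rbrakk>
      \<Longrightarrow> bij_betw (\<pi> X Z) (hom D (F_obj F X) Z) (hom C X (F_obj G Z))"
    and adj_natural: "\<lbrakk>u \<in> hom C X' X; f \<in> hom D (F_obj F X) Z; v \<in> hom D Z Z'\<rbrakk>
      \<Longrightarrow> \<pi> X' Z' (v \<cdot>\<^bsub>D\<^esub> f \<cdot>\<^bsub>D\<^esub> F_arr F u) = F_arr G v \<cdot>\<^bsub>C\<^esub> \<pi> X Z f \<cdot>\<^bsub>C\<^esub> u"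

record ('o, 'a) monoidal_category = "('o, 'a) category" +
  Tensor :: "('o \<times> 'o, 'a \<times> 'a, 'o, 'a) functor_data"
  Unit :: "'o"
  Assoc :: "'o \<Rightarrow> 'o \<Rightarrow> 'o \<Rightarrow> 'a"
  LUnit :: "'o \<Rightarrow> 'a"
  RUnit :: "'o \<Rightarrow> 'a"

text \<open>The tensor product is written \<open>\<otimes>\<close> on objects and \<open>\<boxtimes>\<close> on arrows.\<close>

abbreviation tensor_obj ::
  "('o, 'a, 'z) monoidal_category_scheme \<Rightarrow> 'o \<Rightarrow> 'o \<Rightarrow> 'o" (infixr "\<otimes>\<index>" 70) where
  "X \<otimes>\<^bsub>V\<^esub> Y \<equiv> F_obj (Tensor V) (X, Y)"

abbreviation tensor_arr ::
  "('o, 'a, 'z) monoidal_category_scheme \<Rightarrow> 'a \<Rightarrow> 'a \<Rightarrow> 'a" (infixr "\<boxtimes>\<index>" 70) where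
  "f \<boxtimes>\<^bsub>V\<^esub> g \<equiv> F_arr (Tensor V) (f, g)"

locale monoidal_category = category V
  for V :: "('o, 'a, 'z) monoidal_category_scheme" (structure) +
  assumes Unit_closed: "Unit V \<in> Obj V"
    and Tensor_functor: "is_functor (prod_category V V) V (Tensor V)"
    and Assoc_natural_iso:
      "natural_isomorphism (prod_category (prod_category V V) V) V
        \<lparr>F_obj = (\<lambda>((X, Y), Z). (X \<otimes> Y) \<otimes> Z), F_arr = (\<lambda>((f, g), h). (f \<boxtimes> g) \<boxtimes> h)\<rparr>
        \<lparr>F_obj = (\<lambda>((X, Y), Z). X \<otimes> (Y \<otimes> Z)), F_arr = (\<lambda>((f, g), h). f \<boxtimes> (g \<boxtimes> h))\<rparr>
        (\<lambda>((X, Y), Z). Assoc V X Y Z)"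
    and LUnit_natural_iso:
      "natural_isomorphism V V
        \<lparr>F_obj = (\<lambda>X. Unit V \<otimes> X), F_arr = (\<lambda>f. \<one> (Unit V) \<boxtimes> f)\<rparr> identity_functor (LUnit V)"
    and RUnit_natural_iso:
      "natural_isomorphism V V
        \<lparr>F_obj = (\<lambda>X. X \<otimes> Unit V), F_arr = (\<lambda>f. f \<boxtimes> \<one> (Unit V))\<rparr> identity_functor (RUnit V)"
    and pentagon: "\<lbrakk>W \<in> Obj V; X \<in> Obj V; Y \<in> Obj V; Z \<in> Obj V\<rbrakk> \<Longrightarrow>
      Assoc V W X (Y \<otimes> Z) \<cdot> Assoc V (W \<otimes> X) Y Z =
      (\<one> W \<boxtimes> Assoc V X Y Z) \<cdot> Assoc V W (X \<otimes> Y) Z \<cdot> (Assoc V W X Y \<boxtimes> \<one> Z)"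
    and triangle: "\<lbrakk>X \<in> Obj V; Y \<in> Obj V\<rbrakk> \<Longrightarrow>
      (\<one> X \<boxtimes> LUnit V Y) \<cdot> Assoc V X (Unit V) Y = RUnit V X \<boxtimes> \<one> Y"

text \<open>\<open>IHom V Y\<close> is the right adjoint of \<open>- \<otimes> Y\<close>, and \<open>Curry V X Y Z\<close> is the adjunction bijection
  from \<open>V(X \<otimes> Y, Z)\<close> to \<open>V(X, IHom(Y, Z))\<close>.\<close>

record ('o, 'a) closed_monoidal_category = "('o, 'a) monoidal_category" +
  IHom :: "'o \<Rightarrow> ('o, 'a, 'o, 'a) functor_data"
  Curry :: "'o \<Rightarrow> 'o \<Rightarrow> 'o \<Rightarrow> 'a \<Rightarrow> 'a"

abbreviation ihom ::
  "('o, 'a, 'z) closed_monoidal_category_scheme \<Rightarrow> 'o \<Rightarrow> 'o \<Rightarrow> 'o" where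
  "ihom V Y Z \<equiv> F_obj (IHom V Y) Z"

locale closed_monoidal_category = monoidal_category V
  for V :: "('o, 'a, 'z) closed_monoidal_category_scheme" (structure) +
  assumes closed: "Y \<in> Obj V \<Longrightarrow>
    adjunction V V \<lparr>F_obj = (\<lambda>X. X \<otimes> Y), F_arr = (\<lambda>f. f \<boxtimes> \<one> Y)\<rparr>
      (IHom V Y) (\<lambda>X Z. Curry V X Y Z)"

definition counit :: "('o, 'a, 'z) closed_monoidal_category_scheme \<Rightarrow> 'o \<Rightarrow> 'o \<Rightarrow> 'a" where
  "counit V Y Z =
     the_inv_into (hom V (ihom V Y Z \<otimes>\<^bsub>V\<^esub> Y) Z) (Curry V (ihom V Y Z) Y Z)
       (\<one>\<^bsub>V\<^esub> (ihom V Y Z))"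

text \<open>\<open>SHom\<close> is the functor \<open>S\<^sup>o\<^sup>p \<times> S \<rightarrow> V\<close>, \<open>SComp S X Y Z\<close> is the morphism
  \<open>S(Y, Z) \<otimes> S(X, Y) \<rightarrow> S(X, Z)\<close> of \<open>V\<close>, and \<open>Name S f\<close> is \<open>\<phi>(f) : I \<rightarrow> S(X, Y)\<close>
  for \<open>f : X \<rightarrow> Y\<close>; since \<open>f\<close> determines \<open>X\<close> and \<open>Y\<close>, \<open>Name\<close> needs no object indices.\<close>

record ('o, 'a, 'vo, 'va) structured_category = "('o, 'a) category" +
  SHom :: "('o \<times> 'o, 'a \<times> 'a, 'vo, 'va) functor_data"
  SComp :: "'o \<Rightarrow> 'o \<Rightarrow> 'o \<Rightarrow> 'va"
  Name :: "'a \<Rightarrow> 'va"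

abbreviation shom ::
  "('o, 'a, 'vo, 'va, 'z) structured_category_scheme \<Rightarrow> 'o \<Rightarrow> 'o \<Rightarrow> 'vo" where
  "shom S X Y \<equiv> F_obj (SHom S) (X, Y)"

abbreviation shom_arr ::
  "('o, 'a, 'vo, 'va, 'z) structured_category_scheme \<Rightarrow> 'a \<Rightarrow> 'a \<Rightarrow> 'va" where
  "shom_arr S f g \<equiv> F_arr (SHom S) (f, g)"

text \<open>\<open>Name_bij\<close> and \<open>Name_natural\<close> together state that \<open>Name\<close> is a natural isomorphism of
  set-valued functors from \<open>S(-, -)\<close> to \<open>V(I, SHom(-, -))\<close> on \<open>S\<^sup>o\<^sup>p \<times> S\<close>.\<close>

locale structured_category = V: monoidal_category V + S: category S
  for V :: "('vo, 'va, 'y) monoidal_category_scheme"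
    and S :: "('o, 'a, 'vo, 'va, 'z) structured_category_scheme" +
  assumes SHom_functor: "is_functor (prod_category (op_category S) S) V (SHom S)"
    and SComp_closed: "\<lbrakk>X \<in> Obj S; Y \<in> Obj S; Z \<in> Obj S\<rbrakk> \<Longrightarrow>
      SComp S X Y Z \<in> hom V (shom S Y Z \<otimes>\<^bsub>V\<^esub> shom S X Y) (shom S X Z)"
    and Name_bij: "\<lbrakk>X \<in> Obj S; Y \<in> Obj S\<rbrakk> \<Longrightarrow>
      bij_betw (Name S) (hom S X Y) (hom V (Unit V) (shom S X Y))"
    and Name_natural: "\<lbrakk>u \<in> hom S X' X; f \<in> hom S X Y; v \<in> hom S Y Y'\<rbrakk> \<Longrightarrow>
      Name S (v \<cdot>\<^bsub>S\<^esub> f \<cdot>\<^bsub>S\<^esub> u) = shom_arr S u v \<cdot>\<^bsub>V\<^esub> Name S f"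
    and SComp_assoc: "\<lbrakk>X \<in> Obj S; Y \<in> Obj S; Z \<in> Obj S; W \<in> Obj S\<rbrakk> \<Longrightarrow>
      SComp S X Y W \<cdot>\<^bsub>V\<^esub> (SComp S Y Z W \<boxtimes>\<^bsub>V\<^esub> \<one>\<^bsub>V\<^esub> (shom S X Y)) =
      SComp S X Z W \<cdot>\<^bsub>V\<^esub> (\<one>\<^bsub>V\<^esub> (shom S Z W) \<boxtimes>\<^bsub>V\<^esub> SComp S X Y Z)
        \<cdot>\<^bsub>V\<^esub> Assoc V (shom S Z W) (shom S Y Z) (shom S X Y)"
    and SHom_left: "\<lbrakk>f \<in> hom S X Y; Z \<in> Obj S\<rbrakk> \<Longrightarrow>
      shom_arr S f (\<one>\<^bsub>S\<^esub> Z) =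
      SComp S X Y Z \<cdot>\<^bsub>V\<^esub> (\<one>\<^bsub>V\<^esub> (shom S Y Z) \<boxtimes>\<^bsub>V\<^esub> Name S f)
        \<cdot>\<^bsub>V\<^esub> inv_arr V (RUnit V (shom S Y Z))"
    and SHom_right: "\<lbrakk>X \<in> Obj S; g \<in> hom S Y Z\<rbrakk> \<Longrightarrow>
      shom_arr S (\<one>\<^bsub>S\<^esub> X) g =
      SComp S X Y Z \<cdot>\<^bsub>V\<^esub> (Name S g \<boxtimes>\<^bsub>V\<^esub> \<one>\<^bsub>V\<^esub> (shom S X Y))
        \<cdot>\<^bsub>V\<^esub> inv_arr V (LUnit V (shom S X Y))"

text \<open>\<open>cylinder V S K X KX \<alpha> \<Phi>\<close> says that the triple \<open>(KX, \<alpha>, \<Phi>)\<close> is a \<open>K\<close>-cylinder of \<open>X\<close>;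
  the values \<open>\<Phi> Y\<close> matter only for \<open>Y \<in> Obj S\<close>.\<close>

definition cylinder ::
  "('vo, 'va, 'y) closed_monoidal_category_scheme \<Rightarrow>
   ('o, 'a, 'vo, 'va, 'z) structured_category_scheme \<Rightarrow>
   'vo \<Rightarrow> 'o \<Rightarrow> 'o \<Rightarrow> 'va \<Rightarrow> ('o \<Rightarrow> 'va) \<Rightarrow> bool" where
  "cylinder V S K X KX \<alpha> \<Phi> \<longleftrightarrow>
     KX \<in> Obj S \<and>
     \<alpha> \<in> hom V K (shom S X KX) \<and>
     (\<forall>Y\<in>Obj S.
        \<Phi> Y \<in> hom V (shom S KX Y) (ihom V K (shom S X Y)) \<and>
        is_iso V (\<Phi> Y) \<and>
        counit V K (shom S X Y) \<cdot>\<^bsub>V\<^esub> (\<Phi> Y \<boxtimes>\<^bsub>V\<^esub> \<one>\<^bsub>V\<^esub> K) =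
        SComp S X KX Y \<cdot>\<^bsub>V\<^esub> (\<one>\<^bsub>V\<^esub> (shom S KX Y) \<boxtimes>\<^bsub>V\<^esub> \<alpha>))"

end

theory Submission
  imports Defs "HOL-Library.FuncSet"
begin

text \<open>For a cylinder \<open>(K \<otimes> X, \<alpha>, \<Phi>)\<close> the composite of bijections
  \<open>S(K \<otimes> X, Y) \<rightarrow> V(I, S(K \<otimes> X, Y)) \<rightarrow> V(I, V(K, S(X, Y))) \<rightarrow> V(I \<otimes> K, S(X, Y)) \<rightarrow> V(K, S(X, Y))\<close>
  given by \<open>\<phi>\<close>, \<open>\<Phi>\<close>, the closed structure and \<open>l\<close> sends \<open>f\<close> to \<open>S(X, f) \<cdot> \<alpha>\<close>. So \<open>\<alpha>\<close> is a universal
  element of the functor \<open>V(K, S(X, -))\<close>, and universal elements are unique up to a unique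
  isomorphism.\<close>

section \<open>Hom-sets of opposite and product categories\<close>

lemma homD:
  assumes "f \<in> hom C X Y"
  shows "f \<in> Arr C" "Dom C f = X" "Cod C f = Y"
  using assms by (auto simp: hom_def)

lemma hom_op_category: "hom (op_category C) X Y = hom C Y X"
  by (auto simp: hom_def op_category_def)

lemma hom_prod_category: "hom (prod_category C D) (X, X') (Y, Y') = hom C X Y \<times> hom D X' Y'"
  by (auto simp: hom_def prod_category_def)

section \<open>Inverses, and the bijections of hom-sets induced by isomorphisms\<close>

context category
begin

lemma hom_objD:
  assumes "f \<in> hom C X Y"
  shows "X \<in> Obj C" "Y \<in> Obj C"
  using assms Dom_closed Cod_closed by (auto simp: hom_def)

lemma inverse_arrowsI:
  assumes "f \<in> hom C X Y" "g \<in> hom C Y X" "g \<cdot> f = \<one> X" "f \<cdot> g = \<one> Y"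
  shows "inverse_arrows C f g"
  using assms by (simp add: inverse_arrows_def homD)

lemma inverse_arrowsD:
  assumes "inverse_arrows C f g" "f \<in> hom C X Y"
  shows "g \<in> hom C Y X" "g \<cdot> f = \<one> X" "f \<cdot> g = \<one> Y"
  using assms by (auto simp: inverse_arrows_def homD)

text \<open>This uniqueness makes the definite description in \<open>inv_arr\<close> denote an
  actual inverse.\<close>

lemma inverse_arrows_unique:
  assumes "inverse_arrows C f g" "inverse_arrows C f h"
  shows "g = h"
proof -
  have f: "f \<in> hom C (Dom C f) (Cod C f)"
    using assms(1) by (simp add: inverse_arrows_def hom_def)
  note g = inverse_arrowsD[OF assms(1) f] and h = inverse_arrowsD[OF assms(2) f]
  have "g = (h \<cdot> f) \<cdot> g"
    using g h Comp_Ident_left by simp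
  also have "\<dots> = h"
    using Comp_assoc[OF g(1) f h(1)] g h Comp_Ident_right by simp
  finally show ?thesis .
qed

lemma inverse_arrows_inv_arr:
  assumes "is_iso C f"
  shows "inverse_arrows C f (inv_arr C f)"
  using assms inverse_arrows_unique unfolding is_iso_def inv_arr_def by (metis theI)

lemma inv_arr:
  assumes "is_iso C f" "f \<in> hom C X Y"
  shows "inv_arr C f \<in> hom C Y X" "inv_arr C f \<cdot> f = \<one> X" "f \<cdot> inv_arr C f = \<one> Y"
  using inverse_arrowsD[OF inverse_arrows_inv_arr] assms by auto

lemma bij_betw_postcomp_iso:
  assumes f: "is_iso C f" "f \<in> hom C X Y"
  shows "bij_betw (\<lambda>g. f \<cdot> g) (hom C W X) (hom C W Y)"
proof (rule bij_betwI[where g = "\<lambda>g. inv_arr C f \<cdot> g"])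
  note i = inv_arr[OF f]
  show "(\<lambda>g. f \<cdot> g) \<in> hom C W X \<rightarrow> hom C W Y" "(\<lambda>g. inv_arr C f \<cdot> g) \<in> hom C W Y \<rightarrow> hom C W X"
    using f i Comp_closed by auto
  show "inv_arr C f \<cdot> (f \<cdot> g) = g" if "g \<in> hom C W X" for g
    using Comp_assoc[OF that f(2) i(1)] i that Comp_Ident_left by simp
  show "f \<cdot> (inv_arr C f \<cdot> g) = g" if "g \<in> hom C W Y" for g
    using Comp_assoc[OF that i(1) f(2)] i that Comp_Ident_left by simp
qed

text \<open>Stated with the inverse because the last bijection in the chain for a cylinder passes
  from arrows out of \<open>Unit V\<close> \<otimes> K to arrows out of K along the inverse of the
  left unit isomorphism.\<close>

lemma bij_betw_precomp_inv_arr: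
  assumes f: "is_iso C f" "f \<in> hom C X Y"
  shows "bij_betw (\<lambda>g. g \<cdot> inv_arr C f) (hom C X Z) (hom C Y Z)"
proof (rule bij_betwI[where g = "\<lambda>g. g \<cdot> f"])
  note i = inv_arr[OF f]
  show "(\<lambda>g. g \<cdot> inv_arr C f) \<in> hom C X Z \<rightarrow> hom C Y Z" "(\<lambda>g. g \<cdot> f) \<in> hom C Y Z \<rightarrow> hom C X Z"
    using f i Comp_closed by auto
  show "(g \<cdot> inv_arr C f) \<cdot> f = g" if "g \<in> hom C X Z" for g
    using Comp_assoc[OF f(2) i(1) that] i that Comp_Ident_right by simp
  show "(g \<cdot> f) \<cdot> inv_arr C f = g" if "g \<in> hom C Y Z" for g
    using Comp_assoc[OF i(1) f(2) that] i that Comp_Ident_right by simp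
qed

end

section \<open>Bifunctoriality of the tensor product and naturality of the left unit\<close>

context monoidal_category
begin

lemma tensor_closed:
  assumes "f \<in> hom V X Y" "g \<in> hom V X' Y'"
  shows "f \<boxtimes> g \<in> hom V (X \<otimes> X') (Y \<otimes> Y')"
  using is_functor.F_arr_closed[OF Tensor_functor] assms by (simp add: hom_prod_category)

lemma tensor_comp:
  assumes "f \<in> hom V X Y" "g \<in> hom V Y Z" "f' \<in> hom V X' Y'" "g' \<in> hom V Y' Z'"
  shows "(g \<cdot> f) \<boxtimes> (g' \<cdot> f') = (g \<boxtimes> g') \<cdot> (f \<boxtimes> f')"
  \<comment> \<open>The hom-set premises are rewritten first: unfolding \<open>prod_category\<close>
    at once would leave \<open>hom_prod_category\<close> nothing to match.\<close>
  using is_functor.F_Comp[OF Tensor_functor, of "(f, f')" "(X, X')" "(Y, Y')" "(g, g')" "(Z, Z')"]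
    assms by (simp add: hom_prod_category) (simp add: prod_category_def)

text \<open>By bifunctoriality both composites equal f \<boxtimes> g, once identities are
  absorbed.\<close>

lemma tensor_swap:
  assumes "f \<in> hom V X Y" "g \<in> hom V X' Y'"
  shows "(\<one> Y \<boxtimes> g) \<cdot> (f \<boxtimes> \<one> X') = (f \<boxtimes> \<one> Y') \<cdot> (\<one> X \<boxtimes> g)"
proof -
  have ids: "\<one> X \<in> hom V X X" "\<one> Y \<in> hom V Y Y" "\<one> X' \<in> hom V X' X'" "\<one> Y' \<in> hom V Y' Y'"
    using assms hom_objD Ident_closed by blast+
  show ?thesis
    using tensor_comp[OF assms(1) ids(2) ids(3) assms(2)]
      tensor_comp[OF ids(1) assms(1) assms(2) ids(4)] assms
    by (simp add: Comp_Ident_left Comp_Ident_right)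
qed

lemma LUnit:
  assumes "X \<in> Obj V"
  shows "LUnit V X \<in> hom V (Unit V \<otimes> X) X" "is_iso V (LUnit V X)"
  using natural_isomorphism.component_closed[OF LUnit_natural_iso assms]
    natural_isomorphism.component_iso[OF LUnit_natural_iso assms]
  by (auto simp: identity_functor_def)

lemma inv_LUnit:
  assumes "X \<in> Obj V"
  shows "inv_arr V (LUnit V X) \<in> hom V X (Unit V \<otimes> X)"
    and "inv_arr V (LUnit V X) \<cdot> LUnit V X = \<one> (Unit V \<otimes> X)"
    and "LUnit V X \<cdot> inv_arr V (LUnit V X) = \<one> X"
  using inv_arr[OF LUnit(2)[OF assms] LUnit(1)[OF assms]] by auto

text \<open>Insert \<open>LUnit V X\<close> and its inverse to the right of f, apply the naturality
  square of \<open>LUnit\<close>, and cancel \<open>LUnit V Y\<close> against its inverse on the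
  left.\<close>

lemma inv_LUnit_natural:
  assumes f: "f \<in> hom V X Y"
  shows "inv_arr V (LUnit V Y) \<cdot> f = (\<one> (Unit V) \<boxtimes> f) \<cdot> inv_arr V (LUnit V X)"
proof -
  note X = hom_objD(1)[OF f] and Y = hom_objD(2)[OF f]
  note t = tensor_closed[OF Ident_closed[OF Unit_closed] f]
  have nat: "LUnit V Y \<cdot> (\<one> (Unit V) \<boxtimes> f) = f \<cdot> LUnit V X"
    using natural_isomorphism.naturality[OF LUnit_natural_iso f] by (simp add: identity_functor_def)
  have "inv_arr V (LUnit V Y) \<cdot> f = inv_arr V (LUnit V Y) \<cdot> ((f \<cdot> LUnit V X) \<cdot> inv_arr V (LUnit V X))"
    using Comp_assoc[OF inv_LUnit(1)[OF X] LUnit(1)[OF X] f] inv_LUnit(3)[OF X]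
      Comp_Ident_right[OF f] by simp
  also have "\<dots> = (inv_arr V (LUnit V Y) \<cdot> LUnit V Y) \<cdot> ((\<one> (Unit V) \<boxtimes> f) \<cdot> inv_arr V (LUnit V X))"
    using nat Comp_assoc[OF inv_LUnit(1)[OF X] t LUnit(1)[OF Y]]
      Comp_assoc[OF Comp_closed[OF inv_LUnit(1)[OF X] t] LUnit(1)[OF Y] inv_LUnit(1)[OF Y]] by simp
  also have "\<dots> = (\<one> (Unit V) \<boxtimes> f) \<cdot> inv_arr V (LUnit V X)"
    using inv_LUnit(2)[OF Y] Comp_Ident_left[OF Comp_closed[OF inv_LUnit(1)[OF X] t]] by simp
  finally show ?thesis .
qed

end

section \<open>Currying and the counit\<close>

context closed_monoidal_category
begin

lemma ihom_closed: "Y \<in> Obj V \<Longrightarrow> Z \<in> Obj V \<Longrightarrow> ihom V Y Z \<in> Obj V"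
  using is_functor.F_obj_closed[OF adjunction.axioms(2)[OF closed]] by blast

lemma Curry_bij:
  assumes "X \<in> Obj V" "Y \<in> Obj V" "Z \<in> Obj V"
  shows "bij_betw (Curry V X Y Z) (hom V (X \<otimes> Y) Z) (hom V X (ihom V Y Z))"
  using adjunction.adj_bij[OF closed[OF assms(2)] assms(1,3)] by simp

text \<open>Since \<open>Curry\<close> is onto, the identity of the internal hom lies in its image,
  so the inverse image taken in the definition of \<open>counit\<close> is a genuine one.\<close>

lemma counit:
  assumes "Y \<in> Obj V" "Z \<in> Obj V"
  shows "counit V Y Z \<in> hom V (ihom V Y Z \<otimes> Y) Z"
    and "Curry V (ihom V Y Z) Y Z (counit V Y Z) = \<one> (ihom V Y Z)"
proof -
  have H: "ihom V Y Z \<in> Obj V"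
    using assms by (rule ihom_closed)
  note bij = Curry_bij[OF H assms]
  have "\<one> (ihom V Y Z) \<in> Curry V (ihom V Y Z) Y Z ` hom V (ihom V Y Z \<otimes> Y) Z"
    using bij Ident_closed[OF H] by (simp add: bij_betw_def)
  with bij show "counit V Y Z \<in> hom V (ihom V Y Z \<otimes> Y) Z"
    and "Curry V (ihom V Y Z) Y Z (counit V Y Z) = \<one> (ihom V Y Z)"
    unfolding counit_def bij_betw_def
    by (auto intro: the_inv_into_into f_the_inv_into_f)
qed

text \<open>Naturality of the adjunction in its first variable, evaluated at the counit:
  precomposing with g \<boxtimes> 1 before currying is precomposing with g afterwards, and the
  counit curries to the identity.\<close>

lemma Curry_counit_comp:
  assumes "Y \<in> Obj V" "Z \<in> Obj V" "g \<in> hom V X (ihom V Y Z)"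
  shows "Curry V X Y Z (counit V Y Z \<cdot> (g \<boxtimes> \<one> Y)) = g"
proof -
  note c = counit[OF assms(1,2)] and t = tensor_closed[OF assms(3) Ident_closed[OF assms(1)]]
  have "F_arr (IHom V Y) (\<one> Z) = \<one> (ihom V Y Z)"
    using is_functor.F_Ident[OF adjunction.axioms(2)[OF closed]] assms(1,2) by blast
  then show ?thesis
    using adjunction.adj_natural[OF closed[OF assms(1)] assms(3), of "counit V Y Z" Z "\<one> Z" Z]
      c assms Ident_closed Comp_Ident_left[OF Comp_closed[OF t c(1)]] Comp_Ident_left
    by simp
qed

text \<open>The inverse of \<open>Curry\<close> is written through the counit because the equation
  that defines a cylinder is.\<close>

lemma bij_betw_uncurry:
  assumes "X \<in> Obj V" "Y \<in> Obj V" "Z \<in> Obj V"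
  shows "bij_betw (\<lambda>g. counit V Y Z \<cdot> (g \<boxtimes> \<one> Y)) (hom V X (ihom V Y Z)) (hom V (X \<otimes> Y) Z)"
proof (rule bij_betwI[where g = "Curry V X Y Z"])
  show u: "(\<lambda>g. counit V Y Z \<cdot> (g \<boxtimes> \<one> Y)) \<in> hom V X (ihom V Y Z) \<rightarrow> hom V (X \<otimes> Y) Z"
    using Comp_closed[OF tensor_closed counit(1)] Ident_closed assms by blast
  note bij = Curry_bij[OF assms]
  then show C: "Curry V X Y Z \<in> hom V (X \<otimes> Y) Z \<rightarrow> hom V X (ihom V Y Z)"
    by (auto simp: bij_betw_def)
  show "Curry V X Y Z (counit V Y Z \<cdot> (g \<boxtimes> \<one> Y)) = g" if "g \<in> hom V X (ihom V Y Z)" for g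
    using Curry_counit_comp assms that by blast
  \<comment> \<open>Both sides have the same image under \<open>Curry\<close> by the preceding
    claim, and \<open>Curry\<close> is injective.\<close>
  then show "counit V Y Z \<cdot> (Curry V X Y Z f \<boxtimes> \<one> Y) = f" if "f \<in> hom V (X \<otimes> Y) Z" for f
    using bij u C that by (auto simp: bij_betw_def Pi_iff dest: inj_onD)
qed

end

section \<open>The functors S(X, -) with values in V\<close>

context structured_category
begin

lemma shom_closed: "X \<in> Obj S \<Longrightarrow> Y \<in> Obj S \<Longrightarrow> shom S X Y \<in> Obj V"
  using is_functor.F_obj_closed[OF SHom_functor, of "(X, Y)"]
  by (simp add: prod_category_def op_category_def)

lemma shom_arr_closed:
  assumes "X \<in> Obj S" "f \<in> hom S Y Z"
  shows "shom_arr S (\<one>\<^bsub>S\<^esub> X) f \<in> hom V (shom S X Y) (shom S X Z)"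
  using is_functor.F_arr_closed[OF SHom_functor] assms S.Ident_closed
  by (simp add: hom_prod_category hom_op_category)

lemma shom_arr_Ident:
  assumes "X \<in> Obj S" "Y \<in> Obj S"
  shows "shom_arr S (\<one>\<^bsub>S\<^esub> X) (\<one>\<^bsub>S\<^esub> Y) = \<one>\<^bsub>V\<^esub> (shom S X Y)"
  using is_functor.F_Ident[OF SHom_functor, of "(X, Y)"] assms
  by (simp add: prod_category_def op_category_def)

lemma shom_arr_comp:
  assumes "W \<in> Obj S" "f \<in> hom S X Y" "g \<in> hom S Y Z"
  shows "shom_arr S (\<one>\<^bsub>S\<^esub> W) (g \<cdot>\<^bsub>S\<^esub> f) = shom_arr S (\<one>\<^bsub>S\<^esub> W) g \<cdot>\<^bsub>V\<^esub> shom_arr S (\<one>\<^bsub>S\<^esub> W) f"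
proof -
  have "\<one>\<^bsub>S\<^esub> W \<in> hom S W W"
    using assms(1) by (rule S.Ident_closed)
  then show ?thesis
    using is_functor.F_Comp[OF SHom_functor, of "(\<one>\<^bsub>S\<^esub> W, f)" "(W, X)" "(W, Y)" "(\<one>\<^bsub>S\<^esub> W, g)" "(W, Z)"]
      assms S.Comp_Ident_left
    by (simp add: hom_prod_category hom_op_category) (simp add: prod_category_def op_category_def)
qed

end

section \<open>Cylinders as universal elements\<close>

locale closed_structured_category = V: closed_monoidal_category V + structured_category V S
  for V :: "('vo, 'va, 'y) closed_monoidal_category_scheme"
    and S :: "('o, 'a, 'vo, 'va, 'z) structured_category_scheme"
begin

text \<open>The left side is the value at f of the chain of four bijections. The proof moves
  \<alpha> to the far right, so that what remains on its left is the formula for S(X, f) in terms of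
  composition and \<open>Name S f\<close>.\<close>

lemma cylinder_representation:
  assumes cyl: "cylinder V S K X KX \<alpha> \<Phi>" and K: "K \<in> Obj V" and X: "X \<in> Obj S"
    and f: "f \<in> hom S KX Y"
  shows "(counit V K (shom S X Y) \<cdot>\<^bsub>V\<^esub> ((\<Phi> Y \<cdot>\<^bsub>V\<^esub> Name S f) \<boxtimes>\<^bsub>V\<^esub> \<one>\<^bsub>V\<^esub> K)) \<cdot>\<^bsub>V\<^esub> inv_arr V (LUnit V K) =
    shom_arr S (\<one>\<^bsub>S\<^esub> X) f \<cdot>\<^bsub>V\<^esub> \<alpha>"
proof -
  note KX = S.hom_objD(1)[OF f] and Y = S.hom_objD(2)[OF f]
  let ?I = "Unit V" and ?A = "shom S X KX" and ?B = "shom S X Y" and ?H = "shom S KX Y"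
  let ?n = "Name S f" and ?l = "inv_arr V (LUnit V K)" and ?l' = "inv_arr V (LUnit V (shom S X KX))"
  let ?M = "SComp S X KX Y" and ?\<epsilon> = "counit V K (shom S X Y)"
  have A: "?A \<in> Obj V" and B: "?B \<in> Obj V" and H: "?H \<in> Obj V"
    using shom_closed KX X Y by auto
  have \<alpha>: "\<alpha> \<in> hom V K ?A" and \<Phi>: "\<Phi> Y \<in> hom V ?H (ihom V K ?B)"
    and eq: "?\<epsilon> \<cdot>\<^bsub>V\<^esub> (\<Phi> Y \<boxtimes>\<^bsub>V\<^esub> \<one>\<^bsub>V\<^esub> K) = ?M \<cdot>\<^bsub>V\<^esub> (\<one>\<^bsub>V\<^esub> ?H \<boxtimes>\<^bsub>V\<^esub> \<alpha>)"
    using cyl Y by (auto simp: cylinder_def)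
  have n: "?n \<in> hom V ?I ?H"
    using Name_bij[OF KX Y] f by (auto simp: bij_betw_def)
  note ids = V.Ident_closed[OF K] V.Ident_closed[OF A] V.Ident_closed[OF H] V.Ident_closed[OF V.Unit_closed]
  note M = SComp_closed[OF X KX Y]
  note l = V.inv_LUnit(1)[OF K] and l' = V.inv_LUnit(1)[OF A]
  note nK = V.tensor_closed[OF n ids(1)] and nA = V.tensor_closed[OF n ids(2)]
    and H\<alpha> = V.tensor_closed[OF ids(3) \<alpha>] and I\<alpha> = V.tensor_closed[OF ids(4) \<alpha>]
  have "?\<epsilon> \<cdot>\<^bsub>V\<^esub> ((\<Phi> Y \<cdot>\<^bsub>V\<^esub> ?n) \<boxtimes>\<^bsub>V\<^esub> \<one>\<^bsub>V\<^esub> K) = ?\<epsilon> \<cdot>\<^bsub>V\<^esub> (\<Phi> Y \<boxtimes>\<^bsub>V\<^esub> \<one>\<^bsub>V\<^esub> K) \<cdot>\<^bsub>V\<^esub> (?n \<boxtimes>\<^bsub>V\<^esub> \<one>\<^bsub>V\<^esub> K)"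
    using V.tensor_comp[OF n \<Phi> ids(1) ids(1)] V.Comp_Ident_left[OF ids(1)] by simp
  \<comment> \<open>The cylinder equation trades the counit and \<Phi> for composition and
    \<alpha>.\<close>
  also have "\<dots> = ?M \<cdot>\<^bsub>V\<^esub> (\<one>\<^bsub>V\<^esub> ?H \<boxtimes>\<^bsub>V\<^esub> \<alpha>) \<cdot>\<^bsub>V\<^esub> (?n \<boxtimes>\<^bsub>V\<^esub> \<one>\<^bsub>V\<^esub> K)"
    using V.Comp_assoc[OF nK V.tensor_closed[OF \<Phi> ids(1)] V.counit(1)[OF K B]]
      V.Comp_assoc[OF nK H\<alpha> M] eq by simp
  \<comment> \<open>Interchange: \<open>Name S f\<close> and \<alpha> act on different tensor
    factors, so \<alpha> can act first.\<close>
  also have "\<dots> = (?M \<cdot>\<^bsub>V\<^esub> (?n \<boxtimes>\<^bsub>V\<^esub> \<one>\<^bsub>V\<^esub> ?A)) \<cdot>\<^bsub>V\<^esub> (\<one>\<^bsub>V\<^esub> ?I \<boxtimes>\<^bsub>V\<^esub> \<alpha>)"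
    using V.tensor_swap[OF n \<alpha>] V.Comp_assoc[OF I\<alpha> nA M] by simp
  finally have "(?\<epsilon> \<cdot>\<^bsub>V\<^esub> ((\<Phi> Y \<cdot>\<^bsub>V\<^esub> ?n) \<boxtimes>\<^bsub>V\<^esub> \<one>\<^bsub>V\<^esub> K)) \<cdot>\<^bsub>V\<^esub> ?l =
      (?M \<cdot>\<^bsub>V\<^esub> (?n \<boxtimes>\<^bsub>V\<^esub> \<one>\<^bsub>V\<^esub> ?A)) \<cdot>\<^bsub>V\<^esub> (\<one>\<^bsub>V\<^esub> ?I \<boxtimes>\<^bsub>V\<^esub> \<alpha>) \<cdot>\<^bsub>V\<^esub> ?l"
    using V.Comp_assoc[OF l I\<alpha> V.Comp_closed[OF nA M]] by simp
  \<comment> \<open>Naturality of the inverse left unit strips the factor \<open>Unit V\<close> off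
    \<alpha>.\<close>
  also have "\<dots> = (?M \<cdot>\<^bsub>V\<^esub> (?n \<boxtimes>\<^bsub>V\<^esub> \<one>\<^bsub>V\<^esub> ?A)) \<cdot>\<^bsub>V\<^esub> ?l' \<cdot>\<^bsub>V\<^esub> \<alpha>"
    using V.inv_LUnit_natural[OF \<alpha>] by simp
  also have "\<dots> = (?M \<cdot>\<^bsub>V\<^esub> (?n \<boxtimes>\<^bsub>V\<^esub> \<one>\<^bsub>V\<^esub> ?A) \<cdot>\<^bsub>V\<^esub> ?l') \<cdot>\<^bsub>V\<^esub> \<alpha>"
    using V.Comp_assoc[OF \<alpha> l' V.Comp_closed[OF nA M]] V.Comp_assoc[OF l' nA M] by simp
  finally show ?thesis
    using SHom_right[OF X f] by simp
qed

lemma cylinder_universal: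
  assumes cyl: "cylinder V S K X KX \<alpha> \<Phi>" and K: "K \<in> Obj V" and X: "X \<in> Obj S"
    and Y: "Y \<in> Obj S"
  shows "bij_betw (\<lambda>f. shom_arr S (\<one>\<^bsub>S\<^esub> X) f \<cdot>\<^bsub>V\<^esub> \<alpha>) (hom S KX Y) (hom V K (shom S X Y))"
proof -
  have KX: "KX \<in> Obj S" and \<Phi>: "\<Phi> Y \<in> hom V (shom S KX Y) (ihom V K (shom S X Y))" "is_iso V (\<Phi> Y)"
    using cyl Y by (auto simp: cylinder_def)
  \<comment> \<open>In order of application: naming f, composing with \<Phi> Y, uncurrying, and
    precomposing with the inverse of \<open>LUnit V K\<close>. The composite agrees on the hom-set
    with the map in the goal by \<open>cylinder_representation\<close>.\<close>
  note bij = bij_betw_trans[OF bij_betw_trans[OF bij_betw_trans[OF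
        Name_bij[OF KX Y] V.bij_betw_postcomp_iso[OF \<Phi>(2,1)]]
        V.bij_betw_uncurry[OF V.Unit_closed K shom_closed[OF X Y]]]
        V.bij_betw_precomp_inv_arr[OF V.LUnit(2,1)[OF K]]]
  show ?thesis
    by (rule bij_betw_cong[THEN iffD1, OF _ bij]) (simp add: cylinder_representation[OF cyl K X])
qed

text \<open>The identity also fixes \<alpha>, as S(X, -) preserves identities; injectivity in
  \<open>cylinder_universal\<close> at Y = KX then leaves no other choice.\<close>

lemma cylinder_endo_Ident:
  assumes cyl: "cylinder V S K X KX \<alpha> \<Phi>" and K: "K \<in> Obj V" and X: "X \<in> Obj S"
    and f: "f \<in> hom S KX KX" "shom_arr S (\<one>\<^bsub>S\<^esub> X) f \<cdot>\<^bsub>V\<^esub> \<alpha> = \<alpha>"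
  shows "f = \<one>\<^bsub>S\<^esub> KX"
proof -
  have KX: "KX \<in> Obj S" and \<alpha>: "\<alpha> \<in> hom V K (shom S X KX)"
    using cyl by (auto simp: cylinder_def)
  have "shom_arr S (\<one>\<^bsub>S\<^esub> X) (\<one>\<^bsub>S\<^esub> KX) \<cdot>\<^bsub>V\<^esub> \<alpha> = \<alpha>"
    using shom_arr_Ident[OF X KX] V.Comp_Ident_left[OF \<alpha>] by simp
  then show ?thesis
    using inj_onD[OF bij_betw_imp_inj_on[OF cylinder_universal[OF cyl K X KX]]] f S.Ident_closed[OF KX]
    by simp
qed

text \<open>By functoriality of S(X, -) the composite of g after f fixes \<alpha>. The statement
  covers one composite only; exchanging the two cylinders gives the other.\<close>

lemma cylinder_inverse:
  assumes cyl: "cylinder V S K X KX \<alpha> \<Phi>" and K: "K \<in> Obj V" and X: "X \<in> Obj S"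
    and f: "f \<in> hom S KX KX'" "\<alpha>' = shom_arr S (\<one>\<^bsub>S\<^esub> X) f \<cdot>\<^bsub>V\<^esub> \<alpha>"
    and g: "g \<in> hom S KX' KX" "\<alpha> = shom_arr S (\<one>\<^bsub>S\<^esub> X) g \<cdot>\<^bsub>V\<^esub> \<alpha>'"
  shows "g \<cdot>\<^bsub>S\<^esub> f = \<one>\<^bsub>S\<^esub> KX"
proof (rule cylinder_endo_Ident[OF cyl K X])
  show "g \<cdot>\<^bsub>S\<^esub> f \<in> hom S KX KX"
    using f(1) g(1) by (rule S.Comp_closed)
  have "\<alpha> \<in> hom V K (shom S X KX)"
    using cyl by (simp add: cylinder_def)
  then show "shom_arr S (\<one>\<^bsub>S\<^esub> X) (g \<cdot>\<^bsub>S\<^esub> f) \<cdot>\<^bsub>V\<^esub> \<alpha> = \<alpha>"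
    using V.Comp_assoc[OF _ shom_arr_closed[OF X f(1)] shom_arr_closed[OF X g(1)]]
      shom_arr_comp[OF X f(1) g(1)] f(2)[symmetric] g(2)[symmetric] by simp
qed

end

section \<open>Uniqueness of cylinders\<close>

theorem proposition1p5:
  fixes V :: "('vo, 'va, 'y) closed_monoidal_category_scheme"
    and S :: "('o, 'a, 'vo, 'va, 'z) structured_category_scheme"
    and K :: 'vo and X KX KX' :: 'o
    and \<alpha> \<alpha>' :: 'va and \<Phi> \<Phi>' :: "'o \<Rightarrow> 'va"
  assumes "closed_monoidal_category V"
    and "structured_category V S"
    and "K \<in> Obj V" and "X \<in> Obj S"
    and "cylinder V S K X KX \<alpha> \<Phi>"
    and "cylinder V S K X KX' \<alpha>' \<Phi>'"
  shows "\<exists>!f. f \<in> hom S KX KX' \<and> is_iso S f \<and>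
           \<alpha>' = shom_arr S (\<one>\<^bsub>S\<^esub> X) f \<cdot>\<^bsub>V\<^esub> \<alpha>"
proof -
  interpret closed_structured_category V S
    using assms(1,2) by (rule closed_structured_category.intro)
  note K = assms(3) and X = assms(4) and cyl = assms(5) and cyl' = assms(6)
  have KX: "KX \<in> Obj S" "\<alpha> \<in> hom V K (shom S X KX)"
    and KX': "KX' \<in> Obj S" "\<alpha>' \<in> hom V K (shom S X KX')"
    using cyl cyl' by (auto simp: cylinder_def)
  note bij = cylinder_universal[OF cyl K X KX'(1)] and bij' = cylinder_universal[OF cyl' K X KX(1)]
  \<comment> \<open>Surjectivity for the first cylinder, at the object KX', hits \<alpha>';
    symmetrically g comes from the second cylinder, at KX, hitting \<alpha>.\<close>
  obtain f where f: "f \<in> hom S KX KX'" "\<alpha>' = shom_arr S (\<one>\<^bsub>S\<^esub> X) f \<cdot>\<^bsub>V\<^esub> \<alpha>"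
    using bij KX'(2) by (auto simp: bij_betw_def)
  obtain g where g: "g \<in> hom S KX' KX" "\<alpha> = shom_arr S (\<one>\<^bsub>S\<^esub> X) g \<cdot>\<^bsub>V\<^esub> \<alpha>'"
    using bij' KX(2) by (auto simp: bij_betw_def)
  have "is_iso S f"
    using S.inverse_arrowsI[OF f(1) g(1) cylinder_inverse[OF cyl K X f g]
        cylinder_inverse[OF cyl' K X g f]]
    by (auto simp: is_iso_def)
  \<comment> \<open>Injectivity for the first cylinder at KX' gives uniqueness among all arrows,
    hence among isomorphisms.\<close>
  moreover have "h = f" if "h \<in> hom S KX KX'" "\<alpha>' = shom_arr S (\<one>\<^bsub>S\<^esub> X) h \<cdot>\<^bsub>V\<^esub> \<alpha>" for h
    using inj_onD[OF bij_betw_imp_inj_on[OF bij]] that f by simp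
  ultimately show ?thesis
    using f by blast
qed

end
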